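(* Let $(a_n)_{n\ge1}$ be a sequence of positive real numbers such that $$a_n>\sum_{m>n}a_m\qquad\text{for every }n\ge1,$$ and such that, with $\tau_n:=\sum_{m>n}a_m$, $$2^n\Bigl(\log\frac1{\tau_n}\Bigr)^{-s}\longrightarrow0\qquad\text{for every }s>0.$$ Define $$K:=\left\{\sum_{n=1}^\infty\varepsilon_na_n:\ \varepsilon_n\in\{0,1\}\text{ for all }n\right\}.$$ Then: (1) $K\subset\mathbb R$ is a Cantor set. (2) $\dim_H^{\log}(K)=0$. (3) There exist three countably infinite sets $S_1,S_2,S_3\subset K$ such that $S_1+S_2+S_3\subset K$. Hence every such $K$ is a Cantor set of logarithmic Hausdorff dimension zero that contains a triple sumset of three infinite sequences, and it therefore satisfies the conclusion of the Erdős similarity conjecture.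
   Context: A Cantor set is a nonempty compact, perfect, totally disconnected subset of $\mathbb R$ (equivalently, homeomorphic to $\{0,1\}^{\mathbb N}$). $S_1+S_2+S_3=\{s_1+s_2+s_3:s_i\in S_i\}$. For $s>0$ let $h_s(r)=(\log(1/r))^{-s}$ for $0<r<e^{-1}$ (with $h_s(0)=0$), and let $\mathcal H^{h_s}(F)=\lim_{\delta\to0}\inf\{\sum_ih_s(\operatorname{diam}U_i):\operatorname{diam}(U_i)<\delta,\ F\subset\bigcup_iU_i\}$ over countable covers; the logarithmic Hausdorff dimension is $\dim_H^{\log}(F)=\inf\{s>0:\mathcal H^{h_s}(F)=0\}$. A set $C\subset\mathbb R$ satisfies the conclusion of the Erdős similarity conjecture if there exists a Lebesgue measurable set $F\subset\mathbb R$ of positive Lebesgue measure which contains no affine copy of $C$, i.e. no set $x+tC$ with $x\in\mathbb R$, $t\in\mathbb R\setminus\{0\}$. *)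

theory Defs
  imports "HOL-Analysis.Analysis"
begin

definition cantor_set :: "real set \<Rightarrow> bool" where
  "cantor_set C \<longleftrightarrow> C \<noteq> {} \<and> compact C \<and> {x. x islimpt C} = C \<and>
     (\<forall>x\<in>C. connected_component_set C x = {x})"

(* Only 0 \<le> r < exp (-1) matters: the limit defining log_hausdorff_measure
   disregards larger diameters. *)
definition log_gauge :: "real \<Rightarrow> real \<Rightarrow> real" where
  "log_gauge s r = (if r = 0 then 0 else ln (1 / r) powr (- s))"

(* Finite covers are included, padded with empty sets of diameter 0 and weight 0.
   Boundedness is explicit because the library's diameter is a real number and
   unspecified on unbounded sets. *)
definition log_hausdorff_premeasure :: "real \<Rightarrow> real \<Rightarrow> real set \<Rightarrow> ennreal" where
  "log_hausdorff_premeasure s \<delta> F =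
     Inf {(\<Sum>i. ennreal (log_gauge s (diameter (U i)))) | U :: nat \<Rightarrow> real set.
            (\<forall>i. bounded (U i) \<and> diameter (U i) < \<delta>) \<and> F \<subseteq> (\<Union>i. U i)}"

definition log_hausdorff_measure :: "real \<Rightarrow> real set \<Rightarrow> ennreal" where
  "log_hausdorff_measure s F = Lim (at_right 0) (\<lambda>\<delta>. log_hausdorff_premeasure s \<delta> F)"

(* Extended-real valued, so that the infimum of the empty set is infinity. *)
definition log_hausdorff_dim :: "real set \<Rightarrow> ereal" where
  "log_hausdorff_dim F = Inf (ereal ` {s. 0 < s \<and> log_hausdorff_measure s F = 0})"

definition erdos_similarity_conclusion :: "real set \<Rightarrow> bool" where
  "erdos_similarity_conclusion C \<longleftrightarrow>
     (\<exists>F \<in> sets lebesgue. emeasure lebesgue F > 0 \<and>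
        \<not> (\<exists>x t. t \<noteq> 0 \<and> (\<lambda>c. x + t * c) ` C \<subseteq> F))"

(* Sequences are indexed from 1; the value a 0 is never used. *)
definition tail_sum :: "(nat \<Rightarrow> real) \<Rightarrow> nat \<Rightarrow> real" where
  "tail_sum a n = (\<Sum>k. a (n + 1 + k))"

definition subsum_set :: "(nat \<Rightarrow> real) \<Rightarrow> real set" where
  "subsum_set a = {(\<Sum>k. \<epsilon> (k + 1) * a (k + 1)) | \<epsilon>. \<forall>n\<ge>1. \<epsilon> n \<in> {0, 1}}"

(* The limit in log_hausdorff_measure always exists. *)
lemma log_hausdorff_premeasure_antimono:
  assumes "d \<le> e"
  shows "log_hausdorff_premeasure s e F \<le> log_hausdorff_premeasure s d F"
  unfolding log_hausdorff_premeasure_def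
  by (rule Inf_superset_mono) (use assms in \<open>fastforce intro: less_le_trans\<close>)

lemma log_hausdorff_premeasure_tendsto:
  "((\<lambda>\<delta>. log_hausdorff_premeasure s \<delta> F) \<longlongrightarrow>
      (SUP \<delta>\<in>{0<..}. log_hausdorff_premeasure s \<delta> F)) (at_right 0)"
proof (rule order_tendstoI)
  fix y assume "y < (SUP \<delta>\<in>{0<..}. log_hausdorff_premeasure s \<delta> F)"
  then obtain d where d: "d > 0" "y < log_hausdorff_premeasure s d F"
    by (auto simp: less_SUP_iff)
  have "y < log_hausdorff_premeasure s e F" if "e < d" for e
    using d(2) log_hausdorff_premeasure_antimono[of e d s F] that by (auto intro: less_le_trans)
  then show "eventually (\<lambda>\<delta>. y < log_hausdorff_premeasure s \<delta> F) (at_right 0)"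
    using d(1) by (auto simp: eventually_at_right_field)
next
  fix y assume y: "(SUP \<delta>\<in>{0<..}. log_hausdorff_premeasure s \<delta> F) < y"
  have "log_hausdorff_premeasure s e F < y" if "e > 0" for e
    by (rule le_less_trans[OF _ y]) (rule SUP_upper, use that in simp)
  then show "eventually (\<lambda>\<delta>. log_hausdorff_premeasure s \<delta> F < y) (at_right 0)"
    by (auto simp: eventually_at_right_field intro: exI[of _ 1])
qed

lemma log_hausdorff_measure_eq_SUP:
  "log_hausdorff_measure s F = (SUP \<delta>\<in>{0<..}. log_hausdorff_premeasure s \<delta> F)"
  unfolding log_hausdorff_measure_def
  by (rule tendsto_Lim[OF _ log_hausdorff_premeasure_tendsto]) simp

end

(* The n-digit partial sums cover K by 2^n intervals of length tau_n; the growth condition makes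
   this cover negligible for every h_s and for Lebesgue measure, and a null set of reals is totally
   disconnected. Splitting the indices into residue classes mod 3 gives the triple sumset.

   The similarity statement is proved directly from the digits of K, without Bourgain's theorem on
   triple sumsets. Fix a dyadic range T <= |t| <= 2T. For one term s of the sequence, deleting from
   the line a comb of intervals of length Ts/2 and period 4Ts leaves a set of density 7/8 that
   contains x or x + ts, whatever x and t are. Doing this at m much finer and finer scales and
   choosing one digit per scale, each x + tK meets the intersection of these sets, whose density
   can be made at most (7/8)^m. Removing such small sets for all dyadic ranges from [0,1] leaves a
   set of positive measure without an affine copy of K. *)
theory Submission
  imports Defs
begin

section \<open>Digit expansions and covers by partial sums\<close>

text \<open>Digits are re-indexed from 0, which presents K as an image of the product space of all
  0-1 sequences; compactness rests on this form.\<close>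

lemma subsum_set_eq:
  "subsum_set a = (\<lambda>e. \<Sum>k. e k * a (k + 1)) ` (UNIV \<rightarrow> {0, 1})"
proof (intro equalityI subsetI)
  fix x assume "x \<in> subsum_set a"
  then obtain e where "\<forall>n\<ge>1. e n \<in> {0, 1}" "x = (\<Sum>k. e (k + 1) * a (k + 1))"
    by (auto simp: subsum_set_def)
  then show "x \<in> (\<lambda>e. \<Sum>k. e k * a (k + 1)) ` (UNIV \<rightarrow> {0, 1})"
    by (intro image_eqI[of _ _ "\<lambda>k. e (k + 1)"]) auto
next
  fix x assume "x \<in> (\<lambda>e. \<Sum>k. e k * a (k + 1)) ` (UNIV \<rightarrow> {0, 1})"
  then obtain e where e: "e \<in> UNIV \<rightarrow> {0, 1}" "x = (\<Sum>k. e k * a (k + 1))"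
    by auto
  show "x \<in> subsum_set a"
    unfolding subsum_set_def
    by (rule CollectI, rule exI[of _ "\<lambda>n. e (n - 1)"]) (use e in auto)
qed

lemma summable_digits:
  fixes b e :: "nat \<Rightarrow> real"
  assumes "\<And>n. b n > 0" "summable b" "e \<in> UNIV \<rightarrow> {0, 1}"
  shows "summable (\<lambda>k. e k * b k)"
proof (rule summable_comparison_test'[OF assms(2), of 0])
  fix n
  have "e n \<in> {0, 1}" using assms(3) by auto
  then show "norm (e n * b n) \<le> b n" using assms(1)[of n] by auto
qed

lemma digits_sum_bounds:
  fixes b e :: "nat \<Rightarrow> real"
  assumes "\<And>n. b n > 0" "summable b" "e \<in> UNIV \<rightarrow> {0, 1}"
  shows "(\<Sum>k. e k * b k) \<in> {0..\<Sum>k. b k}"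
proof -
  have e: "e n \<in> {0, 1}" for n using assms(3) by auto
  have "0 \<le> e n * b n \<and> e n * b n \<le> b n" for n
    using e[of n] assms(1)[of n] by auto
  then show ?thesis
    using suminf_nonneg[OF summable_digits[OF assms]]
      suminf_le[OF _ summable_digits[OF assms] assms(2)] by simp
qed

text \<open>Finite subsums are the only points of K that the sumset and similarity arguments
  use.\<close>

lemma finite_sum_in_subsum_set:
  assumes "finite J"
  shows "(\<Sum>k\<in>J. a (k + 1)) \<in> subsum_set a"
proof -
  have "(\<Sum>k\<in>J. a (k + 1)) = (\<Sum>k. of_bool (k \<in> J) * a (k + 1))"
    using assms by (subst suminf_finite[of J]) (auto intro!: sum.cong)
  then show ?thesis unfolding subsum_set_eq by (intro image_eqI) auto
qed

lemma tail_sum_pos: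
  assumes "\<And>n. n \<ge> 1 \<Longrightarrow> a n > 0" "summable (\<lambda>k. a (k + 1))"
  shows "tail_sum a n > 0"
proof -
  have "summable (\<lambda>k. a (k + 1 + n))"
    using assms(2) summable_iff_shift[of "\<lambda>k. a (k + 1)" n] by (simp add: algebra_simps)
  then show ?thesis
    unfolding tail_sum_def using assms(1)
    by (intro suminf_pos) (auto simp: algebra_simps)
qed

lemma tail_sum_tendsto:
  assumes "summable (\<lambda>k. a (k + 1))"
  shows "tail_sum a \<longlonglongrightarrow> 0"
  using suminf_exist_split2[OF assms] by (simp add: tail_sum_def[abs_def] add_ac)

text \<open>The first \<open>n\<close> digits determine the left endpoint \<open>p\<close>, one for
  each subset of \<open>{..<n}\<close>; the remaining digits add something between 0 and
  \<open>tail_sum a n\<close>.\<close>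

lemma subsum_set_cover:
  assumes a: "\<And>n. n \<ge> 1 \<Longrightarrow> a n > 0" "summable (\<lambda>k. a (k + 1))"
  shows "\<exists>P. finite P \<and> card P \<le> 2 ^ n \<and> subsum_set a \<subseteq> (\<Union>p\<in>P. {p..p + tail_sum a n})"
proof (intro exI conjI)
  define P where "P = (\<lambda>J. \<Sum>k\<in>J. a (k + 1)) ` Pow {..<n}"
  show "finite P" by (simp add: P_def)
  show "card P \<le> 2 ^ n"
    using card_image_le[of "Pow {..<n}" "\<lambda>J. \<Sum>k\<in>J. a (k + 1)"] by (simp add: P_def card_Pow)
  show "subsum_set a \<subseteq> (\<Union>p\<in>P. {p..p + tail_sum a n})"
  proof
    fix x assume "x \<in> subsum_set a"
    then obtain e where e: "e \<in> UNIV \<rightarrow> {0, 1}" and x: "x = (\<Sum>k. e k * a (k + 1))"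
      by (auto simp: subsum_set_eq)
    have "summable (\<lambda>k. e k * a (k + 1))"
      using a e by (intro summable_digits) auto
    from suminf_split_initial_segment[OF this, of n]
    have split: "x = (\<Sum>k<n. e k * a (k + 1)) + (\<Sum>k. e (k + n) * a (k + n + 1))"
      by (simp add: x)
    have "(\<Sum>k. e (k + n) * a (k + n + 1)) \<in> {0..\<Sum>k. a (k + n + 1)}"
      using a e summable_iff_shift[of "\<lambda>k. a (k + 1)" n]
      by (intro digits_sum_bounds) auto
    moreover have "(\<Sum>k<n. e k * a (k + 1)) = (\<Sum>k | k < n \<and> e k = 1. a (k + 1))"
    proof (rule sum.mono_neutral_cong_right)
      show "\<forall>k\<in>{..<n} - {k. k < n \<and> e k = 1}. e k * a (k + 1) = 0"
        using e by (auto simp: Pi_iff)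
    qed auto
    moreover have "(\<Sum>k | k < n \<and> e k = 1. a (k + 1)) \<in> P"
      unfolding P_def by (rule imageI) auto
    ultimately show "x \<in> (\<Union>p\<in>P. {p..p + tail_sum a n})"
      unfolding split by (intro UN_I) (auto simp: tail_sum_def add_ac)
  qed
qed

section \<open>Topology of K: compact, perfect, totally disconnected\<close>

text \<open>The digit space is compact by Tychonoff, and the digit sum is continuous on it as a
  uniform limit of finite sums, with \<open>a\<close> itself as the Weierstrass majorant.\<close>

lemma compact_subsum_set:
  assumes a: "\<And>n. n \<ge> 1 \<Longrightarrow> a n > 0" "summable (\<lambda>k. a (k + 1))"
  shows "compact (subsum_set a)"
  unfolding subsum_set_eq
proof (rule compact_continuous_image)
  let ?D = "UNIV \<rightarrow> {0, 1 :: real} :: (nat \<Rightarrow> real) set"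
  show "compact ?D"
    using compactin_PiE[of "\<lambda>_::nat. euclidean :: real topology" UNIV "\<lambda>_. {0, 1}"]
    by (simp add: euclidean_product_topology PiE_UNIV_domain finite_imp_compact)
  have "uniform_limit ?D (\<lambda>n e. \<Sum>k<n. e k * a (k + 1)) (\<lambda>e. \<Sum>k. e k * a (k + 1)) sequentially"
  proof (rule Weierstrass_m_test)
    fix n and e :: "nat \<Rightarrow> real" assume "e \<in> ?D"
    then have "e n \<in> {0, 1}" by auto
    then show "norm (e n * a (n + 1)) \<le> a (n + 1)" using a(1)[of "n + 1"] by auto
  qed fact
  moreover have "continuous_on ?D (\<lambda>e. \<Sum>k<n. e k * a (k + 1))" for n
    by (intro continuous_intros continuous_on_subset[OF continuous_on_product_coordinates]) auto
  ultimately show "continuous_on ?D (\<lambda>e. \<Sum>k. e k * a (k + 1))"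
    by (intro uniform_limit_theorem[rotated]) auto
qed

text \<open>Flipping one digit moves a point by exactly that term of \<open>a\<close>, which is
  nonzero but arbitrarily small far out.\<close>

lemma subsum_set_islimpt:
  assumes a: "\<And>n. n \<ge> 1 \<Longrightarrow> a n > 0" "summable (\<lambda>k. a (k + 1))"
    and x: "x \<in> subsum_set a"
  shows "x islimpt subsum_set a"
proof (unfold islimpt_approachable, intro allI impI)
  fix d :: real assume "d > 0"
  obtain e where e: "e \<in> UNIV \<rightarrow> {0, 1}" and xe: "x = (\<Sum>k. e k * a (k + 1))"
    using x by (auto simp: subsum_set_eq)
  have "\<forall>\<^sub>F n in sequentially. a (n + 1) < d"
    using order_tendstoD(2)[OF summable_LIMSEQ_zero[OF a(2)] \<open>d > 0\<close>] .
  then obtain n where n: "a (n + 1) < d"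
    unfolding eventually_sequentially by blast
  define e' where "e' = e(n := 1 - e n)"
  have e': "e' \<in> UNIV \<rightarrow> {0, 1}" using e by (auto simp: e'_def Pi_iff)
  have pos: "\<And>k. a (k + 1) > 0" using a(1) by simp
  have "(\<Sum>k. e' k * a (k + 1)) - x = (\<Sum>k. e' k * a (k + 1) - e k * a (k + 1))"
    unfolding xe
    by (rule suminf_diff) (rule summable_digits[OF pos a(2)]; fact)+
  \<comment> \<open>The factor \<open>1 - 2 * e n\<close> is 1 or -1, according to the direction of
    the flip.\<close>
  also have "\<dots> = (1 - 2 * e n) * a (n + 1)"
    by (subst suminf_finite[of "{n}"]) (auto simp: e'_def algebra_simps)
  finally have "\<bar>(\<Sum>k. e' k * a (k + 1)) - x\<bar> = a (n + 1)"
    using e pos[of n] by (auto simp: Pi_iff abs_mult dest: spec[of _ n])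
  then show "\<exists>y\<in>subsum_set a. y \<noteq> x \<and> dist y x < d"
    using e' n pos[of n] unfolding subsum_set_eq
    by (intro bexI[of _ "\<Sum>k. e' k * a (k + 1)"]) (auto simp: dist_real_def)
qed

text \<open>A component is an interval; with two distinct points it would contain a segment of
  positive length inside a null set.\<close>

lemma connected_component_set_trivial:
  fixes K :: "real set"
  assumes meas: "K \<in> sets lborel" and null: "emeasure lborel K = 0" and x: "x \<in> K"
  shows "connected_component_set K x = {x}"
proof -
  let ?C = "connected_component_set K x"
  have sub: "?C \<subseteq> K" by (rule connected_component_subset)
  have ord: "u \<ge> v" if "u \<in> ?C" "v \<in> ?C" for u v
  proof (rule ccontr)
    assume "\<not> u \<ge> v"
    have "is_interval ?C" by (simp add: is_interval_connected_1)
    then have "{u..v} \<subseteq> ?C"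
      using that mem_is_interval_1_I[of ?C u v] by (intro subsetI) simp
    then have "emeasure lborel {u..v} \<le> emeasure lborel K"
      using sub meas by (intro emeasure_mono) auto
    then show False using \<open>\<not> u \<ge> v\<close> null by simp
  qed
  have xC: "x \<in> ?C" using x by simp
  have "u = x" if "u \<in> ?C" for u
    using ord[OF that xC] ord[OF xC that] by simp
  then show ?thesis using xC by blast
qed

section \<open>Lebesgue measure and logarithmic Hausdorff measure of K\<close>

lemma subsum_set_null:
  assumes a: "\<And>n. n \<ge> 1 \<Longrightarrow> a n > 0" "summable (\<lambda>k. a (k + 1))"
    and lim: "(\<lambda>n. 2 ^ n * tail_sum a n) \<longlonglongrightarrow> 0"
  shows "emeasure lborel (subsum_set a) = 0"
proof -
  have bound: "emeasure lborel (subsum_set a) \<le> ennreal (2 ^ n * tail_sum a n)" for n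
  proof -
    obtain P where P: "finite P" "card P \<le> 2 ^ n"
      "subsum_set a \<subseteq> (\<Union>p\<in>P. {p..p + tail_sum a n})"
      using subsum_set_cover[OF a] by blast
    have "emeasure lborel (subsum_set a) \<le> emeasure lborel (\<Union>p\<in>P. {p..p + tail_sum a n})"
      using P by (intro emeasure_mono) auto
    also have "\<dots> \<le> (\<Sum>p\<in>P. emeasure lborel {p..p + tail_sum a n})"
      using P(1) by (intro emeasure_subadditive_finite) auto
    also have "\<dots> = of_nat (card P) * ennreal (tail_sum a n)"
      using tail_sum_pos[OF a, of n] by simp
    also have "\<dots> \<le> of_nat (2 ^ n) * ennreal (tail_sum a n)"
      using P(2) by (intro mult_right_mono of_nat_mono) auto
    also have "\<dots> = ennreal (2 ^ n * tail_sum a n)"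
      using tail_sum_pos[OF a, of n]
      by (simp add: ennreal_mult' ennreal_power flip: ennreal_numeral)
    finally show ?thesis .
  qed
  have "(\<lambda>n. ennreal (2 ^ n * tail_sum a n)) \<longlonglongrightarrow> ennreal 0"
    by (intro tendsto_ennrealI lim)
  from LIMSEQ_le_const[OF this] bound show ?thesis by auto
qed

lemma log_hausdorff_measure_subsum_set:
  assumes a: "\<And>n. n \<ge> 1 \<Longrightarrow> a n > 0" "summable (\<lambda>k. a (k + 1))"
    and lim: "(\<lambda>n. 2 ^ n * (ln (1 / tail_sum a n)) powr (- s)) \<longlonglongrightarrow> 0"
  shows "log_hausdorff_measure s (subsum_set a) = 0"
proof -
  have zero: "log_hausdorff_premeasure s d (subsum_set a) = 0" if "d > 0" for d
  proof -
    have bound: "log_hausdorff_premeasure s d (subsum_set a)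
        \<le> ennreal (2 ^ n * (ln (1 / tail_sum a n)) powr (- s))"
      if small: "tail_sum a n < d" for n
    proof -
      have pos: "tail_sum a n > 0" by (rule tail_sum_pos[OF a])
      obtain P where P: "finite P" "card P \<le> 2 ^ n"
        "subsum_set a \<subseteq> (\<Union>p\<in>P. {p..p + tail_sum a n})"
        using subsum_set_cover[OF a] by blast
      obtain f where f: "bij_betw f {..<card P} P"
        using ex_bij_betw_nat_finite[OF P(1)] by (auto simp: atLeast0LessThan)
      \<comment> \<open>The finite cover is padded with empty sets; these have diameter 0 and cost
        nothing because \<open>log_gauge s 0 = 0\<close>.\<close>
      define U where "U i = (if i < card P then {f i..f i + tail_sum a n} else {})" for i
      have diam: "diameter (U i) = (if i < card P then tail_sum a n else 0)" for i
        using pos diameter_cbox[of "f i" "f i + tail_sum a n"]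
        by (auto simp: U_def)
      have "(\<Union>i. U i) = (\<Union>i<card P. {f i..f i + tail_sum a n})"
        by (auto simp: U_def split: if_splits)
      also have "\<dots> = (\<Union>p\<in>P. {p..p + tail_sum a n})"
        using bij_betw_imp_surj_on[OF f] by force
      finally have "subsum_set a \<subseteq> (\<Union>i. U i)" using P(3) by simp
      then have "log_hausdorff_premeasure s d (subsum_set a)
          \<le> (\<Sum>i. ennreal (log_gauge s (diameter (U i))))"
        unfolding log_hausdorff_premeasure_def
        using small \<open>d > 0\<close> by (intro Inf_lower CollectI exI[of _ U]) (auto simp: diam U_def)
      also have "\<dots> = (\<Sum>i<card P. ennreal (log_gauge s (diameter (U i))))"
        by (rule suminf_finite) (auto simp: diam log_gauge_def)
      also have "\<dots> = of_nat (card P) * ennreal (ln (1 / tail_sum a n) powr (- s))"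
        using pos by (simp add: diam log_gauge_def)
      also have "\<dots> \<le> of_nat (2 ^ n) * ennreal (ln (1 / tail_sum a n) powr (- s))"
        using P(2) by (intro mult_right_mono of_nat_mono) auto
      also have "\<dots> = ennreal (2 ^ n * ln (1 / tail_sum a n) powr (- s))"
        by (simp add: ennreal_mult' ennreal_power flip: ennreal_numeral)
      finally show ?thesis .
    qed
    have "(\<lambda>n. ennreal (2 ^ n * (ln (1 / tail_sum a n)) powr (- s))) \<longlonglongrightarrow> ennreal 0"
      by (intro tendsto_ennrealI lim)
    moreover have "\<forall>\<^sub>F n in sequentially. tail_sum a n < d"
      using order_tendstoD(2)[OF tail_sum_tendsto[OF a(2)] \<open>d > 0\<close>] .
    then have "\<forall>\<^sub>F n in sequentially. log_hausdorff_premeasure s d (subsum_set a)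
        \<le> ennreal (2 ^ n * (ln (1 / tail_sum a n)) powr (- s))"
      by eventually_elim (rule bound)
    ultimately have "log_hausdorff_premeasure s d (subsum_set a) \<le> ennreal 0"
      by (rule tendsto_lowerbound) simp
    then show ?thesis by simp
  qed
  show ?thesis
    unfolding log_hausdorff_measure_eq_SUP by (intro antisym SUP_least) (auto simp: zero)
qed

lemma Inf_ereal_positive: "Inf (ereal ` {s. 0 < s}) = 0"
proof (rule antisym)
  show "Inf (ereal ` {s. 0 < s}) \<le> 0"
  proof (rule ccontr)
    assume "\<not> ?thesis"
    then have "0 < Inf (ereal ` {s. 0 < s})" by (simp only: not_le)
    from ereal_dense2[OF this]
    obtain e where e: "0 < ereal e" "ereal e < Inf (ereal ` {s. 0 < s})" by blast
    then have "Inf (ereal ` {s. 0 < s}) \<le> ereal e"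
      by (intro Inf_lower) auto
    then show False using e(2) by simp
  qed
qed (auto intro!: Inf_greatest simp: zero_ereal_def)

text \<open>Derives Lebesgue nullity of K from the growth condition at s = 1: since ln y \<le> y, a
  small \<open>\<tau> n\<close> is at most the reciprocal of
  \<open>ln (1 / \<tau> n)\<close>.\<close>

lemma power_tail_tendsto_0:
  assumes lim: "(\<lambda>n. 2 ^ n * (ln (1 / \<tau> n)) powr (- 1)) \<longlonglongrightarrow> 0"
    and pos: "\<And>n. \<tau> n > 0" and \<tau>: "\<tau> \<longlonglongrightarrow> (0 :: real)"
  shows "(\<lambda>n. 2 ^ n * \<tau> n) \<longlonglongrightarrow> 0"
proof (rule tendsto_sandwich[OF _ _ tendsto_const lim])
  show "\<forall>\<^sub>F n in sequentially. 0 \<le> 2 ^ n * \<tau> n"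
    using pos by (simp add: less_imp_le)
  have "\<forall>\<^sub>F n in sequentially. \<tau> n < 1"
    using order_tendstoD(2)[OF \<tau>, of 1] by simp
  then show "\<forall>\<^sub>F n in sequentially. 2 ^ n * \<tau> n \<le> 2 ^ n * (ln (1 / \<tau> n)) powr (- 1)"
  proof eventually_elim
    fix n assume "\<tau> n < 1"
    then have l: "ln (1 / \<tau> n) > 0" using pos[of n] by simp
    have "ln (1 / \<tau> n) \<le> 1 / \<tau> n"
      using ln_le_minus_one[of "1 / \<tau> n"] pos[of n] by simp
    then have "\<tau> n \<le> 1 / ln (1 / \<tau> n)"
      using l pos[of n] by (simp add: field_simps)
    then show "2 ^ n * \<tau> n \<le> 2 ^ n * (ln (1 / \<tau> n)) powr (- 1)"
      using l mult_left_mono[of "\<tau> n" "1 / ln (1 / \<tau> n)" "2 ^ n"] by (simp add: powr_minus_divide)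
  qed
qed

section \<open>The triple sumset\<close>

text \<open>\<open>a n\<close> is one of the positive terms of \<open>tail_sum a m\<close>. The
  resulting strict decrease makes \<open>a\<close> injective, so each residue class of indices
  yields infinitely many values.\<close>

lemma less_of_tail_less:
  assumes a: "\<And>n. n \<ge> 1 \<Longrightarrow> a n > 0" "summable (\<lambda>k. a (k + 1))"
    and gap: "\<And>n. n \<ge> 1 \<Longrightarrow> a n > tail_sum a n"
    and mn: "1 \<le> m" "m < n"
  shows "a n < a m"
proof -
  have "summable (\<lambda>k. a (m + 1 + k))"
    using a(2) summable_iff_shift[of "\<lambda>k. a (k + 1)" m] by (simp add: algebra_simps)
  then have "sum (\<lambda>k. a (m + 1 + k)) {n - m - 1} \<le> tail_sum a m"
    unfolding tail_sum_def using a(1) by (intro sum_le_suminf) (auto intro: less_imp_le)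
  then show ?thesis using gap[of m] mn by simp
qed

lemma subsum_set_triple_sumset:
  assumes inj: "inj_on a {1..}"
  shows "\<exists>S1 S2 S3. countable S1 \<and> infinite S1 \<and> S1 \<subseteq> subsum_set a \<and>
                     countable S2 \<and> infinite S2 \<and> S2 \<subseteq> subsum_set a \<and>
                     countable S3 \<and> infinite S3 \<and> S3 \<subseteq> subsum_set a \<and>
                     {s1 + s2 + s3 | s1 s2 s3. s1 \<in> S1 \<and> s2 \<in> S2 \<and> s3 \<in> S3} \<subseteq> subsum_set a"
proof -
  define S where "S r = range (\<lambda>k. a (3 * k + r + 1))" for r :: nat
  have "inj (\<lambda>k. a (3 * k + r + 1))" for r
  proof (rule injI)
    fix x y assume "a (3 * x + r + 1) = a (3 * y + r + 1)"
    then have "3 * x + r + 1 = 3 * y + r + 1"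
      by (rule inj_onD[OF inj]) auto
    then show "x = y" by simp
  qed
  then have inf: "infinite (S r)" for r
    unfolding S_def by (rule range_inj_infinite)
  have sub: "S r \<subseteq> subsum_set a" for r
    using finite_sum_in_subsum_set[of "{3 * k + r}" a for k] by (auto simp: S_def)
  have "a (3 * i + 0 + 1) + a (3 * j + 1 + 1) + a (3 * k + 2 + 1) \<in> subsum_set a" for i j k
  proof -
    \<comment> \<open>Indices from different residue classes never coincide, so no digit is used
      twice and the sum is a finite subsum.\<close>
    have "3 * i + 0 \<noteq> 3 * j + 1" "3 * i + 0 \<noteq> 3 * k + 2" "3 * j + 1 \<noteq> 3 * k + 2"
      by presburger+
    then show ?thesis
      using finite_sum_in_subsum_set[of "{3 * i + 0, 3 * j + 1, 3 * k + 2}" a]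
      by (simp add: add_ac)
  qed
  then have sums: "{s1 + s2 + s3 | s1 s2 s3. s1 \<in> S 0 \<and> s2 \<in> S 1 \<and> s3 \<in> S 2} \<subseteq> subsum_set a"
    unfolding S_def by blast
  have cnt: "countable (S r)" for r by (simp add: S_def)
  show ?thesis
    by (intro exI[of _ "S 0"] exI[of _ "S 1"] exI[of _ "S 2"] conjI inf sub cnt sums)
qed

section \<open>The similarity conclusion: combs and small sets meeting every affine copy\<close>

text \<open>For h > 0 and r < 8 this is the union over integers k of the half-open intervals from
  \<open>(8 * k + r) * h / 2\<close> to \<open>(8 * k + r + 1) * h / 2\<close>; the eight combs
  partition the line.\<close>

definition comb :: "real \<Rightarrow> nat \<Rightarrow> real set" where
  "comb h r = {x. \<lfloor>2 * x / h\<rfloor> mod 8 = int r}"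

lemma comb_measurable [measurable]: "comb h r \<in> sets borel"
  unfolding comb_def by measurable

lemma comb_cover: "(\<Union>r<8. comb h r) = UNIV"
proof -
  have "\<exists>r<8. \<lfloor>2 * x / h\<rfloor> mod 8 = int r" for x
    by (rule exI[of _ "nat (\<lfloor>2 * x / h\<rfloor> mod 8)"]) auto
  then show ?thesis
    by (auto simp: comb_def)
qed

text \<open>Points of a comb are either closer than \<open>h / 2\<close> or at distance more than \<open>7 h / 2\<close>,
  so \<open>y\<close> and \<open>y + u\<close> cannot both be near it.\<close>
lemma comb_avoid:
  assumes h: "h > 0" and u: "h \<le> \<bar>u\<bar>" "\<bar>u\<bar> \<le> 2 * h"
  shows "\<exists>c\<in>{0, 1}. \<forall>d. \<bar>d\<bar> \<le> h / 8 \<longrightarrow> y + c * u + d \<notin> comb h r"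
proof (rule ccontr)
  assume "\<not> ?thesis"
  then obtain d d' where d: "\<bar>d\<bar> \<le> h / 8" "\<bar>d'\<bar> \<le> h / 8"
    and mem: "y + d \<in> comb h r" "y + u + d' \<in> comb h r"
    by auto
  \<comment> \<open>In units of \<open>h / 2\<close>, two points of one comb differ by less than 1
    from a multiple of 8, whereas the bounds on \<open>u\<close>, \<open>d\<close>,
    \<open>d'\<close> force a distance between 3/2 and 9/2.\<close>
  define P Q where "P = 2 * (y + d) / h" and "Q = 2 * (y + u + d') / h"
  have "\<lfloor>P\<rfloor> mod 8 = \<lfloor>Q\<rfloor> mod 8"
    using mem by (simp add: comb_def P_def Q_def)
  then obtain k where k: "\<lfloor>Q\<rfloor> = \<lfloor>P\<rfloor> + 8 * k"
    by (metis mod_eqE)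
  have PQ: "\<bar>Q - P - 8 * real_of_int k\<bar> < 1"
    using k by linarith
  have "(Q - P) * h = 2 * (u + d' - d)"
    using h by (simp add: P_def Q_def field_simps)
  then have eq: "\<bar>Q - P\<bar> * h = 2 * \<bar>u + d' - d\<bar>"
    using h by (metis abs_mult abs_numeral abs_of_pos)
  have near: "\<bar>u\<bar> - h / 4 \<le> \<bar>u + d' - d\<bar>" "\<bar>u + d' - d\<bar> \<le> \<bar>u\<bar> + h / 4"
    using d by (simp_all add: abs_le_iff abs_if split: if_splits)
  then have "3 / 2 * h \<le> \<bar>Q - P\<bar> * h"
    unfolding eq using u by argo
  moreover have "\<bar>Q - P\<bar> * h \<le> 9 / 2 * h"
    unfolding eq using near u by argo
  ultimately have "3 / 2 \<le> \<bar>Q - P\<bar>" "\<bar>Q - P\<bar> \<le> 9 / 2"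
    using h by (simp_all add: mult_le_cancel_right)
  then show False
    using PQ by (cases "k = 0"; cases "k \<ge> 1") linarith+
qed

text \<open>Pigeonhole: eight combs cover the line, so one of them takes at least an eighth of
  \<open>A\<close>. The offset \<open>r\<close> may depend on \<open>A\<close>, so no
  equidistribution is required.\<close>

lemma comb_large_portion:
  assumes A: "A \<in> fmeasurable lborel"
  shows "\<exists>r. measure lborel (A - comb h r) \<le> 7 / 8 * measure lborel A"
proof (rule ccontr)
  assume *: "\<not> ?thesis"
  have meas: "A \<inter> comb h r \<in> fmeasurable lborel" for r
    using A by (intro fmeasurable_Int_fmeasurable) auto
  have small: "measure lborel (A \<inter> comb h r) < 1 / 8 * measure lborel A" for r
  proof -
    have "A - comb h r = A - (A \<inter> comb h r)" by auto
    then have "measure lborel (A - comb h r) = measure lborel A - measure lborel (A \<inter> comb h r)"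
      using A meas[of r] by (simp add: measurable_measure_Diff fmeasurableD)
    then show ?thesis
      using * by (auto simp: not_le dest: spec[of _ r])
  qed
  have "measure lborel A = measure lborel (\<Union>r\<in>{..<8}. A \<inter> comb h r)"
    using comb_cover[of h] by (metis Int_UN_distrib Int_UNIV_right)
  also have "\<dots> \<le> (\<Sum>r<8. measure lborel (A \<inter> comb h r))"
    by (intro measure_UNION_le fmeasurableD meas) simp
  also have "\<dots> < (\<Sum>r<(8::nat). 1 / 8 * measure lborel A)"
    by (rule sum_strict_mono) (use small in \<open>auto simp: lessThan_empty_iff\<close>)
  finally show False by simp
qed

lemma sum_le_tail:
  fixes b :: "nat \<Rightarrow> real"
  assumes b: "\<And>n. b n > 0" "summable b" and J: "finite J" "J \<subseteq> {n..}"
  shows "sum b J \<le> (\<Sum>k. b (k + n))"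
proof -
  have "sum b J = sum (\<lambda>k. b (k + n)) ((\<lambda>j. j - n) ` J)"
  proof (subst sum.reindex)
    show "inj_on (\<lambda>j. j - n) J"
      using J by (intro inj_onI) (metis atLeast_iff eq_diff_iff subsetD)
  qed (use J in \<open>auto intro!: sum.cong\<close>)
  also have "\<dots> \<le> (\<Sum>k. b (k + n))"
    using b J by (intro sum_le_suminf) (auto simp: summable_iff_shift less_imp_le)
  finally show ?thesis .
qed

text \<open>Induction on the number of scales: digit \<open>N\<close> avoids one comb, and the
  induction hypothesis treats what is left of \<open>A\<close> with digits from a far later index
  on. Hence both \<open>A\<close> and \<open>N\<close> must vary.\<close>

lemma small_set_meeting_sums:
  fixes b :: "nat \<Rightarrow> real"
  assumes b: "\<And>n. b n > 0" "summable b" and T: "T > 0"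
    and A: "A \<in> fmeasurable lborel"
  shows "\<exists>U\<in>sets borel. measure lborel (A \<inter> U) \<le> (7 / 8) ^ m * measure lborel A \<and>
           (\<forall>x t. T \<le> \<bar>t\<bar> \<and> \<bar>t\<bar> \<le> 2 * T \<longrightarrow>
              (\<exists>J. finite J \<and> J \<subseteq> {N..} \<and> x + t * sum b J \<in> U))"
  using A
proof (induction m arbitrary: N A)
  case 0
  show ?case
    by (rule bexI[of _ UNIV]) (auto intro: exI[of _ "{}"])
next
  case (Suc m)
  \<comment> \<open>With this spacing, \<open>t * b N\<close> has size between \<open>h\<close> and
    \<open>2 * h\<close> throughout the dyadic range, as \<open>comb_avoid\<close> demands.\<close>
  define h where "h = T * b N"
  have h: "h > 0" using b T by (simp add: h_def)
  obtain r where r: "measure lborel (A - comb h r) \<le> 7 / 8 * measure lborel A"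
    using comb_large_portion[OF Suc.prems] by blast
  \<comment> \<open>Multiplied by |t| \<le> 2T, a tail below \<open>b N / 16\<close> moves a point
    by at most \<open>h / 8\<close>, the tolerance of \<open>comb_avoid\<close>.\<close>
  have "\<forall>\<^sub>F n in sequentially. (\<Sum>k. b (k + n)) < b N / 16"
    using order_tendstoD(2)[OF suminf_exist_split2[OF b(2)], of "b N / 16"] b(1)[of N] by simp
  then obtain n0 where n0: "\<And>n. n \<ge> n0 \<Longrightarrow> (\<Sum>k. b (k + n)) < b N / 16"
    unfolding eventually_sequentially by blast
  \<comment> \<open>\<open>Suc N\<close> keeps index \<open>N\<close> out of the later digits, so it
    can still be inserted.\<close>
  define M where "M = max n0 (Suc N)"
  have A': "A - comb h r \<in> fmeasurable lborel"
    using Suc.prems by (intro fmeasurable_Diff) auto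
  obtain U where U: "U \<in> sets borel"
    "measure lborel ((A - comb h r) \<inter> U) \<le> (7 / 8) ^ m * measure lborel (A - comb h r)"
    "\<And>x t. \<lbrakk>T \<le> \<bar>t\<bar>; \<bar>t\<bar> \<le> 2 * T\<rbrakk> \<Longrightarrow> \<exists>J. finite J \<and> J \<subseteq> {M..} \<and> x + t * sum b J \<in> U"
    using Suc.IH[OF A', of M] by blast
  have "measure lborel (A \<inter> (U - comb h r)) = measure lborel ((A - comb h r) \<inter> U)"
    by (rule arg_cong[where f = "measure lborel"]) auto
  also have "\<dots> \<le> (7 / 8) ^ m * (7 / 8 * measure lborel A)"
    using U(2) r by (meson mult_left_mono order_trans zero_le_divide_iff zero_le_numeral zero_le_power)
  finally have small: "measure lborel (A \<inter> (U - comb h r)) \<le> (7 / 8) ^ Suc m * measure lborel A"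
    by simp
  have "\<exists>J. finite J \<and> J \<subseteq> {N..} \<and> x + t * sum b J \<in> U - comb h r"
    if t: "T \<le> \<bar>t\<bar>" "\<bar>t\<bar> \<le> 2 * T" for x t
  proof -
    have "h \<le> \<bar>t * b N\<bar>" "\<bar>t * b N\<bar> \<le> 2 * h"
      using t b(1)[of N] T by (auto simp: h_def abs_mult)
    \<comment> \<open>Digit \<open>c\<close> is fixed first, with room for every later correction;
      \<open>J\<close> is then found for the shifted base point
      \<open>x + c * (t * b N)\<close>.\<close>
    from comb_avoid[OF h this] obtain c where c: "c \<in> {0, 1}"
      and avoid: "\<And>d. \<bar>d\<bar> \<le> h / 8 \<Longrightarrow> x + c * (t * b N) + d \<notin> comb h r"
      by blast
    obtain J where J: "finite J" "J \<subseteq> {M..}" "x + c * (t * b N) + t * sum b J \<in> U"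
      using U(3)[OF t] by blast
    have "sum b J \<le> b N / 16"
      using sum_le_tail[OF b J(1,2)] n0[of M] by (simp add: M_def)
    moreover have "sum b J \<ge> 0"
      using b(1) by (simp add: sum_nonneg less_imp_le)
    ultimately have "\<bar>t\<bar> * sum b J \<le> 2 * T * (b N / 16)"
      using t T by (intro mult_mono) auto
    then have "\<bar>t * sum b J\<bar> \<le> h / 8"
      using \<open>sum b J \<ge> 0\<close> by (simp add: abs_mult h_def)
    from avoid[OF this] have notin: "x + c * (t * b N) + t * sum b J \<notin> comb h r" .
    define J' where "J' = (if c = 0 then J else insert N J)"
    have "N \<notin> J" using J(2) by (auto simp: M_def)
    then have eq: "x + t * sum b J' = x + c * (t * b N) + t * sum b J"
      using c J(1) by (auto simp: J'_def algebra_simps)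
    have "x + t * sum b J' \<in> U - comb h r"
      unfolding eq using J(3) notin by blast
    moreover have "finite J'" "J' \<subseteq> {N..}"
      using J(1,2) by (auto simp: J'_def M_def)
    ultimately show ?thesis
      by blast
  qed
  moreover have "U - comb h r \<in> sets borel" using U(1) by auto
  ultimately show ?case using small by blast
qed

text \<open>Every nonzero \<open>t\<close> lies in one of countably many dyadic ranges, enumerated
  by \<open>int_decode\<close>. Range \<open>i\<close> costs at most
  \<open>(1 / 2) ^ (i + 2)\<close> of the unit interval, in total at most one half.\<close>

lemma erdos_similarity_finite_sums:
  fixes b :: "nat \<Rightarrow> real"
  assumes b: "\<And>n. b n > 0" "summable b"
    and K: "\<And>J. finite J \<Longrightarrow> sum b J \<in> K"
  shows "erdos_similarity_conclusion K"
proof -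
  have "\<exists>U\<in>sets borel. measure lborel ({0..1} \<inter> U) \<le> (1 / 2) ^ Suc (Suc i) \<and>
           (\<forall>x t. 2 powi int_decode i \<le> \<bar>t\<bar> \<and> \<bar>t\<bar> \<le> 2 * 2 powi int_decode i \<longrightarrow>
              (\<exists>J. finite J \<and> x + t * sum b J \<in> U))" for i
  proof -
    obtain m where m: "(7 / 8) ^ m < ((1 / 2) ^ Suc (Suc i) :: real)"
      using real_arch_pow_inv[of "(1 / 2) ^ Suc (Suc i)" "7 / 8 :: real"] by auto
    have "(2 :: real) powi int_decode i > 0" "{0..1::real} \<in> fmeasurable lborel"
      by (simp_all add: fmeasurable_def)
    from small_set_meeting_sums[OF b this, of m 0] obtain V
      where V: "V \<in> sets borel" "measure lborel ({0..1} \<inter> V) \<le> (7 / 8) ^ m"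
        "\<And>x t. \<lbrakk>2 powi int_decode i \<le> \<bar>t\<bar>; \<bar>t\<bar> \<le> 2 * 2 powi int_decode i\<rbrakk>
           \<Longrightarrow> \<exists>J. finite J \<and> x + t * sum b J \<in> V"
      by auto
    have "measure lborel ({0..1} \<inter> V) \<le> (1 / 2) ^ Suc (Suc i)"
      using V(2) m by linarith
    then show ?thesis using V(1,3) by blast
  qed
  then obtain U where U: "\<And>i. U i \<in> sets borel"
    "\<And>i. measure lborel ({0..1} \<inter> U i) \<le> (1 / 2) ^ Suc (Suc i)"
    "\<And>i x t. \<lbrakk>2 powi int_decode i \<le> \<bar>t\<bar>; \<bar>t\<bar> \<le> 2 * 2 powi int_decode i\<rbrakk>
       \<Longrightarrow> \<exists>J. finite J \<and> x + t * sum b J \<in> U i"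
    by metis
  define F where "F = {0..1} - (\<Union>i. U i)"
  have F: "F \<in> sets borel" unfolding F_def using U(1) by auto
  have "emeasure lborel (\<Union>i. {0..1} \<inter> U i) \<le> (\<Sum>i. emeasure lborel ({0..1} \<inter> U i))"
    using U(1) by (intro emeasure_subadditive_countably) auto
  also have "\<dots> \<le> (\<Sum>i. ennreal (1 / 2 * (1 / 2) ^ Suc i))"
  proof (rule suminf_le)
    fix i
    have "{0..1} \<inter> U i \<in> fmeasurable lborel"
      using U(1) by (intro fmeasurable_Int_fmeasurable) (auto simp: fmeasurable_def)
    then show "emeasure lborel ({0..1} \<inter> U i) \<le> ennreal (1 / 2 * (1 / 2) ^ Suc i)"
      using U(2)[of i] by (subst emeasure_eq_measure2) (auto intro!: ennreal_leI)
  qed auto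
  also have "\<dots> = ennreal (1 / 2 * 1)"
    by (intro suminf_ennreal_eq sums_mult power_half_series) auto
  finally have half: "emeasure lborel (\<Union>i. {0..1} \<inter> U i) \<le> ennreal (1 / 2)" by simp
  have pos: "emeasure lborel F > 0"
  proof (rule ccontr)
    assume "\<not> ?thesis"
    then have F0: "emeasure lborel F = 0" by simp
    have "ennreal 1 = emeasure lborel {0..1::real}" by simp
    also have "\<dots> \<le> emeasure lborel (F \<union> (\<Union>i. {0..1} \<inter> U i))"
      using F U(1) by (intro emeasure_mono) (auto simp: F_def)
    also have "\<dots> \<le> emeasure lborel F + emeasure lborel (\<Union>i. {0..1} \<inter> U i)"
      using F U(1) by (intro emeasure_subadditive) auto
    also have "\<dots> \<le> ennreal (1 / 2)" using half F0 by simp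
    finally show False by (subst (asm) ennreal_le_iff) auto
  qed
  have "\<not> (\<lambda>c. x + t * c) ` K \<subseteq> F" if "t \<noteq> 0" for x t :: real
  proof -
    \<comment> \<open>The dyadic range of \<open>t\<close>; the set \<open>U i\<close> removed for
      it contains a point of the copy \<open>x + t * K\<close>.\<close>
    define j where "j = \<lfloor>log 2 \<bar>t\<bar>\<rfloor>"
    define i where "i = int_encode j"
    have "2 powr real_of_int j \<le> \<bar>t\<bar>" "\<bar>t\<bar> < 2 powr (real_of_int j + 1)"
      using that floor_correct[of "log 2 \<bar>t\<bar>"]
      by (simp_all add: j_def flip: le_log_iff log_less_iff)
    then have "2 powi int_decode i \<le> \<bar>t\<bar>" "\<bar>t\<bar> \<le> 2 * 2 powi int_decode i"
      by (auto simp: i_def powr_real_of_int' powr_add)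
    from U(3)[OF this, of x] obtain J where "finite J" "x + t * sum b J \<in> U i" by blast
    then show ?thesis using K[of J] by (auto simp: F_def)
  qed
  then show ?thesis
    unfolding erdos_similarity_conclusion_def using F pos
    by (intro bexI[of _ F]) (auto simp: sets_completionI_sets)
qed

theorem proposition4p1:
  fixes a :: "nat \<Rightarrow> real"
  assumes "\<And>n. n \<ge> 1 \<Longrightarrow> a n > 0"
    and "summable (\<lambda>k. a (k + 1))"
    and "\<And>n. n \<ge> 1 \<Longrightarrow> a n > tail_sum a n"
    and "\<And>s::real. s > 0 \<Longrightarrow>
           (\<lambda>n. 2 ^ n * (ln (1 / tail_sum a n)) powr (- s)) \<longlonglongrightarrow> 0"
  shows "cantor_set (subsum_set a) \<and>
         log_hausdorff_dim (subsum_set a) = 0 \<and>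
         (\<exists>S1 S2 S3. countable S1 \<and> infinite S1 \<and> S1 \<subseteq> subsum_set a \<and>
                     countable S2 \<and> infinite S2 \<and> S2 \<subseteq> subsum_set a \<and>
                     countable S3 \<and> infinite S3 \<and> S3 \<subseteq> subsum_set a \<and>
                     {s1 + s2 + s3 | s1 s2 s3. s1 \<in> S1 \<and> s2 \<in> S2 \<and> s3 \<in> S3} \<subseteq> subsum_set a) \<and>
         erdos_similarity_conclusion (subsum_set a)"
proof (intro conjI)
  note a = assms(1,2)
  have pos: "tail_sum a n > 0" for n by (rule tail_sum_pos[OF a])
  have lim: "(\<lambda>n. 2 ^ n * tail_sum a n) \<longlonglongrightarrow> 0"
    by (rule power_tail_tendsto_0[OF assms(4)[of 1] pos tail_sum_tendsto[OF a(2)]]) simp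
  have null: "emeasure lborel (subsum_set a) = 0"
    by (rule subsum_set_null[OF a lim])
  have compact: "compact (subsum_set a)" by (rule compact_subsum_set[OF a])
  then have closed: "closed (subsum_set a)" by (rule compact_imp_closed)
  have "0 \<in> subsum_set a" using finite_sum_in_subsum_set[of "{}" a] by simp
  moreover have "{x. x islimpt subsum_set a} = subsum_set a"
    using closed subsum_set_islimpt[OF a] by (auto simp: closed_limpt)
  moreover have "connected_component_set (subsum_set a) x = {x}" if "x \<in> subsum_set a" for x
    using closed by (intro connected_component_set_trivial[OF _ null that]) simp
  ultimately show "cantor_set (subsum_set a)"
    using compact by (auto simp: cantor_set_def)
  \<comment> \<open>The measure vanishes for every positive exponent, so the dimension is the
    infimum of all positive reals.\<close>
  have "{s. 0 < s \<and> log_hausdorff_measure s (subsum_set a) = 0} = {s. 0 < s}"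
    using log_hausdorff_measure_subsum_set[OF a assms(4)] by blast
  then show "log_hausdorff_dim (subsum_set a) = 0"
    unfolding log_hausdorff_dim_def by (simp add: Inf_ereal_positive)
  have "inj_on a {1..}"
  proof (rule linorder_inj_onI)
    fix m n :: nat assume "m < n" "m \<in> {1..}"
    then show "a m \<noteq> a n"
      using less_of_tail_less[OF assms(1-3), of m n] by auto
  qed auto
  then show "\<exists>S1 S2 S3. countable S1 \<and> infinite S1 \<and> S1 \<subseteq> subsum_set a \<and>
                     countable S2 \<and> infinite S2 \<and> S2 \<subseteq> subsum_set a \<and>
                     countable S3 \<and> infinite S3 \<and> S3 \<subseteq> subsum_set a \<and>
                     {s1 + s2 + s3 | s1 s2 s3. s1 \<in> S1 \<and> s2 \<in> S2 \<and> s3 \<in> S3} \<subseteq> subsum_set a"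
    by (rule subsum_set_triple_sumset)
  show "erdos_similarity_conclusion (subsum_set a)"
    using assms(1) finite_sum_in_subsum_set
    by (intro erdos_similarity_finite_sums[OF _ a(2)]) auto
qed

end
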